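(* Let $G$ be an Abelian group and $S$ a subsemigroup of $G$ with $0\in S$. The following conditions are equivalent: (1) the paratopological group $G_{\vec S}$ is $2$-pseudocompact; (2) each power of $G_{\vec S}$ is $2$-pseudocompact; (3) the space $G_{\vec S}$ is countably o-compact; (4) the subgroup $S-S$ has finite index in $G$ and each countable subset of $S-S$ is contained in the set $a-S$ for some $a\in S$; (5) each infinite subset of $G$ has infinite intersection with the set $a-S$ for some $a\in G$.
   Context: For an Abelian group $G$ (written additively) and a subsemigroup $S\ni 0$ of $G$, $G_{\vec S}$ denotes the group $G$ endowed with the topology consisting of all sets $U\subseteq G$ such that for every $u\in U$ there exists $x\in S$ with $u+x+S\subseteq U$; it is a paratopological group (addition is continuous). Here $S-S=\{s-t:s,t\in S\}$ and $a-S=\{a-s:s\in S\}$. Powers $G_{\vec S}^\kappa$ ($\kappa$ any cardinal) carry the product group structure and the Tychonoff product topology. A paratopological group (written additively) is $2$-pseudocompact if $\bigcap_{n\in\omega}\overline{-U_n}\neq\emptyset$ for each decreasing sequence $(U_n)_{n\in\omega}$ of nonempty open subsets. A space is countably o-compact if each decreasing sequence $(U_n)_{n\in\omega}$ of nonempty open sets has nonempty intersection. No separation axioms are assumed. *)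

theory Defs
  imports "HOL-Analysis.Analysis" "HOL-Algebra.Product_Groups"
begin

(* frees the syntax of topological closure_of *)
no_notation eq_closure_of (\<open>closure'_of\<index>\<close>)

text \<open>
  Abelian groups are rendered as HOL-Algebra's multiplicatively written \<^locale>\<open>comm_group\<close>,
  so that arbitrary powers are available as \<^const>\<open>product_group\<close>. The additive notation
  translates as follows: \<open>a + S\<close> is \<open>a <#\<^bsub>G\<^esub> S\<close>, \<open>-S\<close> is \<open>set_inv\<^bsub>G\<^esub> S\<close>, \<open>a - S\<close> is
  \<open>a <#\<^bsub>G\<^esub> (set_inv\<^bsub>G\<^esub> S)\<close>, and \<open>S - S\<close> is \<open>S <#>\<^bsub>G\<^esub> (set_inv\<^bsub>G\<^esub> S)\<close>.
\<close>

definition cone_open :: "('a, 'b) monoid_scheme \<Rightarrow> 'a set \<Rightarrow> 'a set \<Rightarrow> bool" where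
  "cone_open G S U \<longleftrightarrow>
     U \<subseteq> carrier G \<and> (\<forall>u\<in>U. \<exists>x\<in>S. (u \<otimes>\<^bsub>G\<^esub> x) <#\<^bsub>G\<^esub> S \<subseteq> U)"

definition cone_topology :: "('a, 'b) monoid_scheme \<Rightarrow> 'a set \<Rightarrow> 'a topology" where
  "cone_topology G S = topology (cone_open G S)"

definition paratopological_group :: "('a, 'b) monoid_scheme \<Rightarrow> 'a topology \<Rightarrow> bool" where
  "paratopological_group G X \<longleftrightarrow>
     group G \<and> topspace X = carrier G \<and>
     continuous_map (prod_topology X X) X (\<lambda>(x, y). x \<otimes>\<^bsub>G\<^esub> y)"

definition two_pseudocompact :: "('a, 'b) monoid_scheme \<Rightarrow> 'a topology \<Rightarrow> bool" where
  "two_pseudocompact G X \<longleftrightarrow>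
     (\<forall>U :: nat \<Rightarrow> 'a set. decseq U \<and> (\<forall>n. openin X (U n) \<and> U n \<noteq> {}) \<longrightarrow>
        (\<Inter>n. X closure_of (set_inv\<^bsub>G\<^esub> (U n))) \<noteq> {})"

definition countably_o_compact :: "'a topology \<Rightarrow> bool" where
  "countably_o_compact X \<longleftrightarrow>
     (\<forall>U :: nat \<Rightarrow> 'a set. decseq U \<and> (\<forall>n. openin X (U n) \<and> U n \<noteq> {}) \<longrightarrow>
        (\<Inter>n. U n) \<noteq> {})"

definition finite_index :: "'a set \<Rightarrow> ('a, 'b) monoid_scheme \<Rightarrow> bool" where
  "finite_index H G \<longleftrightarrow> subgroup H G \<and> finite (rcosets\<^bsub>G\<^esub> H)"

lemma cone_open_subset:
  assumes "cone_open G S U" "u \<in> U"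
  obtains x where "x \<in> S" "\<And>s. s \<in> S \<Longrightarrow> u \<otimes>\<^bsub>G\<^esub> x \<otimes>\<^bsub>G\<^esub> s \<in> U"
  using assms unfolding cone_open_def l_coset_def by blast

lemma istopology_cone_open:
  assumes "comm_group G" "submonoid S G"
  shows "istopology (cone_open G S)"
proof -
  interpret comm_group G by fact
  interpret S: submonoid S G by fact
  show ?thesis
    unfolding istopology_def
  proof (intro conjI allI impI)
    fix U V assume U: "cone_open G S U" and V: "cone_open G S V"
    show "cone_open G S (U \<inter> V)"
      unfolding cone_open_def
    proof (intro conjI ballI)
      show "U \<inter> V \<subseteq> carrier G" using U unfolding cone_open_def by blast
      fix u assume u: "u \<in> U \<inter> V"
      then have uG: "u \<in> carrier G" using U unfolding cone_open_def by blast
      obtain x where x: "x \<in> S" "\<And>s. s \<in> S \<Longrightarrow> u \<otimes>\<^bsub>G\<^esub> x \<otimes>\<^bsub>G\<^esub> s \<in> U"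
        using cone_open_subset[OF U] u by blast
      obtain y where y: "y \<in> S" "\<And>s. s \<in> S \<Longrightarrow> u \<otimes>\<^bsub>G\<^esub> y \<otimes>\<^bsub>G\<^esub> s \<in> V"
        using cone_open_subset[OF V] u by blast
      have "u \<otimes>\<^bsub>G\<^esub> (x \<otimes>\<^bsub>G\<^esub> y) \<otimes>\<^bsub>G\<^esub> s \<in> U \<inter> V" if s: "s \<in> S" for s
      proof -
        have "u \<otimes>\<^bsub>G\<^esub> (x \<otimes>\<^bsub>G\<^esub> y) \<otimes>\<^bsub>G\<^esub> s = u \<otimes>\<^bsub>G\<^esub> x \<otimes>\<^bsub>G\<^esub> (y \<otimes>\<^bsub>G\<^esub> s)"
             "u \<otimes>\<^bsub>G\<^esub> (x \<otimes>\<^bsub>G\<^esub> y) \<otimes>\<^bsub>G\<^esub> s = u \<otimes>\<^bsub>G\<^esub> y \<otimes>\<^bsub>G\<^esub> (x \<otimes>\<^bsub>G\<^esub> s)"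
          using uG x(1) y(1) s by (simp_all add: m_ac)
        then show ?thesis using x y s by (metis IntI S.m_closed)
      qed
      then show "\<exists>x\<in>S. (u \<otimes>\<^bsub>G\<^esub> x) <#\<^bsub>G\<^esub> S \<subseteq> U \<inter> V"
        using x(1) y(1) unfolding l_coset_def by (intro bexI[of _ "x \<otimes>\<^bsub>G\<^esub> y"]) auto
    qed
  next
    fix K assume "\<forall>U\<in>K. cone_open G S U"
    then show "cone_open G S (\<Union>K)" unfolding cone_open_def by (meson Union_iff Union_least Union_upper subset_trans)
  qed
qed

lemma openin_cone_topology:
  assumes "comm_group G" "submonoid S G"
  shows "openin (cone_topology G S) U \<longleftrightarrow>
    U \<subseteq> carrier G \<and> (\<forall>u\<in>U. \<exists>x\<in>S. (u \<otimes>\<^bsub>G\<^esub> x) <#\<^bsub>G\<^esub> S \<subseteq> U)"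
  using topology_inverse'[OF istopology_cone_open[OF assms]]
  by (simp add: cone_topology_def cone_open_def)

lemma topspace_cone_topology:
  assumes "comm_group G" "submonoid S G"
  shows "topspace (cone_topology G S) = carrier G"
proof (rule equalityI)
  interpret comm_group G by fact
  interpret S: submonoid S G by fact
  show "topspace (cone_topology G S) \<subseteq> carrier G"
    using openin_cone_topology[OF assms, of "topspace (cone_topology G S)"] by simp
  have "openin (cone_topology G S) (carrier G)"
    unfolding openin_cone_topology[OF assms] l_coset_def
    by (auto intro!: bexI[OF _ S.one_closed])
  then show "carrier G \<subseteq> topspace (cone_topology G S)" by (rule openin_subset)
qed

lemma paratopological_group_cone_topology:
  assumes "comm_group G" "submonoid S G"
  shows "paratopological_group G (cone_topology G S)"
proof -
  interpret comm_group G by fact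
  interpret S: submonoid S G by fact
  let ?X = "cone_topology G S"
  note op = openin_cone_topology[OF assms] and ts = topspace_cone_topology[OF assms]
  have nbhd: "openin ?X (insert u ((u \<otimes>\<^bsub>G\<^esub> x) <#\<^bsub>G\<^esub> S))"
    if u: "u \<in> carrier G" and x: "x \<in> S" for u x
    unfolding op
  proof (intro conjI ballI)
    show "insert u ((u \<otimes>\<^bsub>G\<^esub> x) <#\<^bsub>G\<^esub> S) \<subseteq> carrier G" using u x by (auto simp: l_coset_def)
    fix w assume "w \<in> insert u ((u \<otimes>\<^bsub>G\<^esub> x) <#\<^bsub>G\<^esub> S)"
    then consider "w = u" | t where "t \<in> S" "w = u \<otimes>\<^bsub>G\<^esub> x \<otimes>\<^bsub>G\<^esub> t" by (auto simp: l_coset_def)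
    then show "\<exists>y\<in>S. (w \<otimes>\<^bsub>G\<^esub> y) <#\<^bsub>G\<^esub> S \<subseteq> insert u ((u \<otimes>\<^bsub>G\<^esub> x) <#\<^bsub>G\<^esub> S)"
    proof cases
      case 1 then show ?thesis using x by blast
    next
      case (2 t)
      have "w \<otimes>\<^bsub>G\<^esub> \<one>\<^bsub>G\<^esub> \<otimes>\<^bsub>G\<^esub> s = u \<otimes>\<^bsub>G\<^esub> x \<otimes>\<^bsub>G\<^esub> (t \<otimes>\<^bsub>G\<^esub> s)" if "s \<in> S" for s
        using 2 u x that by (simp add: m_ac)
      then have "(w \<otimes>\<^bsub>G\<^esub> \<one>\<^bsub>G\<^esub>) <#\<^bsub>G\<^esub> S \<subseteq> (u \<otimes>\<^bsub>G\<^esub> x) <#\<^bsub>G\<^esub> S"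
        using 2(1) S.m_closed unfolding l_coset_def by fastforce
      then show ?thesis using S.one_closed by blast
    qed
  qed
  have "continuous_map (prod_topology ?X ?X) ?X (\<lambda>(x, y). x \<otimes>\<^bsub>G\<^esub> y)"
    unfolding continuous_map_def
  proof (intro conjI allI impI)
    show "(\<lambda>(x, y). x \<otimes>\<^bsub>G\<^esub> y) \<in> topspace (prod_topology ?X ?X) \<rightarrow> topspace ?X" by (auto simp: ts)
    fix U assume U: "openin ?X U"
    show "openin (prod_topology ?X ?X)
            {p \<in> topspace (prod_topology ?X ?X). (\<lambda>(x, y). x \<otimes>\<^bsub>G\<^esub> y) p \<in> U}"
      unfolding openin_prod_topology_alt
    proof (intro allI impI)
      fix u v
      assume "(u, v) \<in> {p \<in> topspace (prod_topology ?X ?X). (\<lambda>(x, y). x \<otimes>\<^bsub>G\<^esub> y) p \<in> U}"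
      then have uv: "u \<in> carrier G" "v \<in> carrier G" "u \<otimes>\<^bsub>G\<^esub> v \<in> U" by (auto simp: ts)
      obtain x where x: "x \<in> S" "\<And>s. s \<in> S \<Longrightarrow> u \<otimes>\<^bsub>G\<^esub> v \<otimes>\<^bsub>G\<^esub> x \<otimes>\<^bsub>G\<^esub> s \<in> U"
        using cone_open_subset[of G S U "u \<otimes>\<^bsub>G\<^esub> v"] U uv(3) unfolding op cone_open_def by metis
      let ?A = "\<lambda>u. insert u ((u \<otimes>\<^bsub>G\<^esub> x) <#\<^bsub>G\<^esub> S)"
      have *: "(u \<otimes>\<^bsub>G\<^esub> x \<otimes>\<^bsub>G\<^esub> s) \<otimes>\<^bsub>G\<^esub> v \<in> U" "u \<otimes>\<^bsub>G\<^esub> (v \<otimes>\<^bsub>G\<^esub> x \<otimes>\<^bsub>G\<^esub> s) \<in> U" if "s \<in> S" for s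
        using x(2)[OF that] uv x(1) that by (simp_all add: m_ac)
      have **: "(u \<otimes>\<^bsub>G\<^esub> x \<otimes>\<^bsub>G\<^esub> s) \<otimes>\<^bsub>G\<^esub> (v \<otimes>\<^bsub>G\<^esub> x \<otimes>\<^bsub>G\<^esub> t) \<in> U" if "s \<in> S" "t \<in> S" for s t
      proof -
        have "x \<otimes>\<^bsub>G\<^esub> (s \<otimes>\<^bsub>G\<^esub> t) \<in> S" using x(1) that by simp
        from x(2)[OF this] show ?thesis using uv x(1) that by (simp add: m_ac)
      qed
      have "?A u \<times> ?A v \<subseteq> {p \<in> topspace (prod_topology ?X ?X). (\<lambda>(x, y). x \<otimes>\<^bsub>G\<^esub> y) p \<in> U}"
        using openin_subset[OF nbhd[OF uv(1) x(1)]] openin_subset[OF nbhd[OF uv(2) x(1)]]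
          uv(3) * ** by (auto simp: l_coset_def)
      then show "\<exists>A B. openin ?X A \<and> openin ?X B \<and> u \<in> A \<and> v \<in> B \<and>
          A \<times> B \<subseteq> {p \<in> topspace (prod_topology ?X ?X). (\<lambda>(x, y). x \<otimes>\<^bsub>G\<^esub> y) p \<in> U}"
        using nbhd uv x(1) by blast
    qed
  qed
  then show ?thesis by (simp add: paratopological_group_def ts)
qed

end

theory Submission
  imports Defs
begin

text \<open>
  Every nonempty open set contains a translate \<open>v + S\<close>, and \<open>a \<in> v + S\<close> iff \<open>v \<in> a - S\<close>. So (5),
  applied to a sequence of such translates inside a decreasing sequence of open sets, gives (3).
  Since \<open>y + S\<close> is a neighbourhood of \<open>y\<close>, a set \<open>U\<close> with \<open>U + S \<subseteq> U\<close> contains \<open>-y\<close> whenever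
  \<open>y\<close> lies in the closure of \<open>-U\<close>; tails of a sequence of cosets of \<open>S - S\<close> and the sets
  \<open>s\<^sub>0 + \<dots> + s\<^sub>n + S\<close> are of this kind, so that (1) gives (4).
  For powers, the cosets of \<open>S - S\<close> of the translating points form a sequence in a power of a
  finite discrete space; a cluster point of it tells which coset to treat in each coordinate, and
  (4) then provides the coordinates of a point in all the closures.
\<close>

(* frees the syntax of l_coset *)
no_notation subset_mset (infix \<open><#\<close> 50)

text \<open>The closures of the tails of the sequence are nested, closed and nonempty, so
  compactness gives a common point. It is applied to cosets in a power of a finite discrete
  space.\<close>

lemma compact_space_cluster_point:
  fixes w :: "nat \<Rightarrow> 'a"
  assumes "compact_space X" and w: "\<And>n. w n \<in> topspace X"
  obtains q where "q \<in> topspace X"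
    "\<And>N n. openin X N \<Longrightarrow> q \<in> N \<Longrightarrow> \<exists>m\<ge>n. w m \<in> N"
proof -
  let ?C = "\<lambda>n. X closure_of (w ` {n..})"
  have "(\<Inter>n. ?C n) \<noteq> {}"
  proof (rule compact_space_imp_nest)
    show "?C n \<noteq> {}" for n
      using w by (subst closure_of_eq_empty) auto
    show "decseq ?C"
      unfolding decseq_def by (intro allI impI closure_of_mono image_mono) auto
  qed (use assms in auto)
  then obtain q where q: "\<And>n. q \<in> ?C n" by auto
  show thesis
  proof
    show "q \<in> topspace X" using q[of 0] by (simp add: in_closure_of)
    show "\<exists>m\<ge>n. w m \<in> N" if "openin X N" "q \<in> N" for N n
      using q[of n] that unfolding in_closure_of by fastforce
  qed
qed

section \<open>The subgroup S - S, translates of S and open sets\<close>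

locale cone = comm_group G + S: submonoid S G for G (structure) and S
begin

abbreviation "X \<equiv> cone_topology G S"
abbreviation "H \<equiv> S <#> set_inv S"

lemmas openin_cone = openin_cone_topology[OF comm_group_axioms S.submonoid_axioms]
lemmas topspace_cone = topspace_cone_topology[OF comm_group_axioms S.submonoid_axioms]

lemma mem_H_iff: "x \<in> H \<longleftrightarrow> (\<exists>s\<in>S. \<exists>t\<in>S. x = s \<otimes> inv t)"
  by (auto simp: set_mult_def SET_INV_def)

lemma S_subset_H: "S \<subseteq> H"
proof
  fix s assume "s \<in> S"
  then have "s = s \<otimes> inv \<one>" by simp
  then show "s \<in> H" unfolding mem_H_iff using \<open>s \<in> S\<close> S.one_closed by blast
qed

lemma subgroup_H: "subgroup H G"
proof (rule subgroupI)
  show "H \<subseteq> carrier G" by (auto simp: mem_H_iff)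
  show "H \<noteq> {}" using S_subset_H S.one_closed by blast
next
  fix x assume "x \<in> H"
  then obtain s t where st: "s \<in> S" "t \<in> S" "x = s \<otimes> inv t" unfolding mem_H_iff by blast
  then have "inv x = t \<otimes> inv s" by (simp add: inv_mult m_comm)
  with st show "inv x \<in> H" unfolding mem_H_iff by blast
next
  fix x y assume "x \<in> H" "y \<in> H"
  then obtain s t s' t' where st: "s \<in> S" "t \<in> S" "x = s \<otimes> inv t"
    "s' \<in> S" "t' \<in> S" "y = s' \<otimes> inv t'" unfolding mem_H_iff by blast
  then have "x \<otimes> y = (s \<otimes> s') \<otimes> inv (t \<otimes> t')"
    by (simp add: inv_mult m_ac)
  with st show "x \<otimes> y \<in> H" unfolding mem_H_iff using S.m_closed by blast
qed

text \<open>Both sides say that a - x lies in S. Thus many points \<open>x\<close> lie in one set a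
  - S exactly when their cones x + S share the point \<open>a\<close>.\<close>

lemma mem_translate_iff:
  assumes "a \<in> carrier G" "x \<in> carrier G"
  shows "x \<in> a <# set_inv S \<longleftrightarrow> a \<in> x <# S"
proof -
  have "x = a \<otimes> inv s \<longleftrightarrow> a = x \<otimes> s" if "s \<in> S" for s
    using that assms by (metis S.mem_carrier inv_closed inv_solve_right m_closed)
  then show ?thesis by (auto simp: l_coset_def SET_INV_def)
qed

lemma self_mem_translate: "x \<in> carrier G \<Longrightarrow> x \<in> x <# S"
  using S.one_closed unfolding l_coset_def by force

lemma translate_absorbs:
  assumes "x \<in> carrier G" "u \<in> x <# S" "s \<in> S"
  shows "u \<otimes> s \<in> x <# S"
proof -
  obtain t where t: "t \<in> S" "u = x \<otimes> t" using assms(2) by (auto simp: l_coset_def)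
  then have "u \<otimes> s = x \<otimes> (t \<otimes> s)" using assms by (simp add: m_assoc)
  then show ?thesis using t assms(3) by (auto simp: l_coset_def)
qed

text \<open>The neutral element serves as the shift \<open>x\<close> at every point of
  \<open>U\<close>.\<close>

lemma openin_absorbing:
  assumes "U \<subseteq> carrier G" "\<And>u s. u \<in> U \<Longrightarrow> s \<in> S \<Longrightarrow> u \<otimes> s \<in> U"
  shows "openin X U"
  unfolding openin_cone
proof (intro conjI ballI)
  fix u assume u: "u \<in> U"
  show "\<exists>x\<in>S. (u \<otimes> x) <# S \<subseteq> U"
  proof
    show "(u \<otimes> \<one>) <# S \<subseteq> U" using u assms by (auto simp: l_coset_def)
  qed simp
qed fact

lemma openin_translate: "x \<in> carrier G \<Longrightarrow> openin X (x <# S)"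
  by (rule openin_absorbing) (auto simp: translate_absorbs l_coset_subset_G S.subset)

lemma openin_contains_translate:
  assumes "openin X U" "U \<noteq> {}"
  obtains v where "v \<in> carrier G" "v <# S \<subseteq> U"
proof -
  obtain u where u: "u \<in> U" using assms by blast
  then obtain x where x: "x \<in> S" "(u \<otimes> x) <# S \<subseteq> U" using assms unfolding openin_cone by blast
  moreover have "u \<otimes> x \<in> carrier G" using u x assms unfolding openin_cone by auto
  ultimately show ?thesis using that by blast
qed

section \<open>Consequences of 2-pseudocompactness\<close>

lemma inv_mem_absorbing:
  assumes "y \<in> X closure_of set_inv U" "U \<subseteq> carrier G"
    and "\<And>u s. u \<in> U \<Longrightarrow> s \<in> S \<Longrightarrow> u \<otimes> s \<in> U"
  shows "inv y \<in> U"
proof -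
  have y: "y \<in> carrier G" using assms(1) by (simp add: in_closure_of topspace_cone)
  obtain z where z: "z \<in> set_inv U" "z \<in> y <# S"
    using assms(1) openin_translate[OF y] self_mem_translate[OF y] unfolding in_closure_of by blast
  then obtain u s where us: "u \<in> U" "s \<in> S" "inv u = y \<otimes> s"
    by (auto simp: SET_INV_def l_coset_def)
  then have "u = inv y \<otimes> inv s" using y assms(2)
    by (metis S.mem_carrier inv_inv inv_mult subsetD)
  then have "u \<otimes> s = inv y" using y us by (simp add: m_assoc)
  then show ?thesis using assms(3)[OF us(1,2)] by simp
qed

lemma Inter_absorbing_nonempty:
  fixes U :: "nat \<Rightarrow> 'a set"
  assumes "two_pseudocompact G X" "decseq U" "\<And>n. U n \<noteq> {}" "\<And>n. U n \<subseteq> carrier G"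
    and "\<And>n u s. u \<in> U n \<Longrightarrow> s \<in> S \<Longrightarrow> u \<otimes> s \<in> U n"
  shows "(\<Inter>n. U n) \<noteq> {}"
proof -
  have "openin X (U n)" for n using assms(4,5) by (rule openin_absorbing)
  then have "(\<Inter>n. X closure_of set_inv (U n)) \<noteq> {}"
    using assms(1-3) unfolding two_pseudocompact_def by simp
  then obtain y where "\<And>n. y \<in> X closure_of set_inv (U n)" by blast
  then have "inv y \<in> U n" for n using assms(4,5) by (rule inv_mem_absorbing)
  then show ?thesis by blast
qed

text \<open>With infinitely many cosets, the unions of the tails of a sequence of distinct cosets
  would have a common point, although distinct cosets are disjoint.\<close>

lemma two_pseudocompact_imp_finite_index:
  assumes "two_pseudocompact G X"
  shows "finite_index H G"
proof (rule ccontr)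
  interpret H: subgroup H G by (rule subgroup_H)
  assume "\<not> finite_index H G"
  then have "infinite (rcosets H)" by (simp add: finite_index_def subgroup_H)
  then obtain Q :: "nat \<Rightarrow> 'a set" where Q: "inj Q" "range Q \<subseteq> rcosets H"
    using infinite_countable_subset by blast
  define U where "U n = (\<Union>m\<in>{n..}. Q m)" for n
  \<comment> \<open>A coset of \<open>H\<close> absorbs S because S lies in
    \<open>H\<close>.\<close>
  have abs: "u \<otimes> s \<in> Q m" if "u \<in> Q m" "s \<in> S" for u s m
  proof -
    have "Q m \<in> rcosets H" using Q(2) by blast
    then obtain g where g: "g \<in> carrier G" "Q m = H #> g" by (auto simp: RCOSETS_def)
    obtain h where h: "h \<in> H" "u = h \<otimes> g" using g \<open>u \<in> Q m\<close> by (auto simp: r_coset_def)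
    then have "u \<otimes> s = (h \<otimes> s) \<otimes> g" using g that by (simp add: m_ac)
    moreover have "h \<otimes> s \<in> H" using h that S_subset_H by blast
    ultimately show ?thesis using g by (auto simp: r_coset_def)
  qed
  have "(\<Inter>n. U n) \<noteq> {}"
  proof (rule Inter_absorbing_nonempty[OF assms])
    show "decseq U" by (fastforce simp: decseq_def U_def)
    show "U n \<noteq> {}" for n
      using Q(2) subgroup.rcosets_non_empty[OF subgroup_H] unfolding U_def by blast
    show "U n \<subseteq> carrier G" for n
      using Q(2) rcosets_part_G[OF subgroup_H] unfolding U_def by blast
    show "u \<otimes> s \<in> U n" if "u \<in> U n" "s \<in> S" for n u s
      using that abs unfolding U_def by blast
  qed
  then obtain z where z: "\<And>n. z \<in> U n" by blast
  obtain m where m: "z \<in> Q m" using z[of 0] by (auto simp: U_def)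
  \<comment> \<open>The tail from \<open>Suc m\<close> on omits the index \<open>m\<close>, so the
    same point lies in a second coset of the sequence.\<close>
  obtain k where k: "k > m" "z \<in> Q k" using z[of "Suc m"] by (auto simp: U_def Suc_le_eq)
  have "Q m = Q k"
  proof (rule ccontr)
    assume "Q m \<noteq> Q k"
    moreover have "Q m \<in> rcosets H" "Q k \<in> rcosets H" using Q(2) by auto
    ultimately have "disjnt (Q m) (Q k)"
      using rcos_disjoint[OF subgroup_H] by (auto dest: pairwiseD)
    then show False using m k(2) by (auto simp: disjnt_iff)
  qed
  then show False using Q(1) k(1) by (auto dest: injD)
qed

text \<open>Write the members of \<open>C\<close> as s n - t n and take a common point
  \<open>a\<close> of the cones at the partial sums p n of the s n. If a = p n + s n + r with r in
  S, then a - c n = p n + t n + r lies in S, which puts c n into a - S.\<close>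

lemma two_pseudocompact_imp_countable_bounded:
  assumes "two_pseudocompact G X" "countable C" "C \<subseteq> H"
  shows "\<exists>a\<in>S. C \<subseteq> a <# set_inv S"
proof (cases "C = {}")
  case True
  then show ?thesis using S.one_closed by blast
next
  case False
  \<comment> \<open>An enumeration, possibly with repetitions; it is onto \<open>C\<close> because
    \<open>C\<close> is nonempty here.\<close>
  define c where "c = from_nat_into C"
  have "c n \<in> H" for n using False assms(3) unfolding c_def by (meson from_nat_into subsetD)
  then have "\<exists>s t. s \<in> S \<and> t \<in> S \<and> c n = s \<otimes> inv t" for n unfolding mem_H_iff by blast
  then obtain s t where st: "\<And>n. s n \<in> S" "\<And>n. t n \<in> S" "\<And>n. c n = s n \<otimes> inv (t n)" by metis
  \<comment> \<open>The sum of the first \<open>n\<close> terms of \<open>s\<close>. As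
    \<open>p 0\<close> is neutral, the cone at index 0 is S itself and forces \<open>a\<close> into
    S.\<close>
  define p where "p n = rec_nat \<one> (\<lambda>k q. q \<otimes> s k) n" for n
  have p_Suc: "p (Suc n) = p n \<otimes> s n" for n by (simp add: p_def)
  have p: "p n \<in> S" for n by (induction n) (simp_all add: p_def st)
  have "(\<Inter>n. p n <# S) \<noteq> {}"
  proof (rule Inter_absorbing_nonempty[OF assms(1)])
    show "decseq (\<lambda>n. p n <# S)"
    proof (rule decseq_SucI)
      fix n
      have "p (Suc n) \<in> p n <# S" unfolding p_Suc using st(1) by (auto simp: l_coset_def)
      then show "p (Suc n) <# S \<subseteq> p n <# S"
        using translate_absorbs[of "p n" "p (Suc n)"] p by (force simp: l_coset_def)
    qed
    show "p n <# S \<noteq> {}" for n using self_mem_translate[of "p n"] p by auto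
    show "p n <# S \<subseteq> carrier G" for n using p by (simp add: l_coset_subset_G S.subset)
    show "u \<otimes> r \<in> p n <# S" if "u \<in> p n <# S" "r \<in> S" for n u r
      using p that by (simp add: translate_absorbs)
  qed
  then obtain a where a: "\<And>n. a \<in> p n <# S" by blast
  have aS: "a \<in> S" using a[of 0] p[of 0] by (auto simp: l_coset_def)
  moreover have "c n \<in> a <# set_inv S" for n
  proof -
    \<comment> \<open>The index is \<open>Suc n\<close> because \<open>s n\<close> first occurs as a
      summand of \<open>p (Suc n)\<close>.\<close>
    obtain r where r: "r \<in> S" "a = p (Suc n) \<otimes> r" using a[of "Suc n"] by (auto simp: l_coset_def)
    have [simp]: "p n \<in> carrier G" "s n \<in> carrier G" "t n \<in> carrier G" "r \<in> carrier G"
      using p st r by auto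
    have "c n \<otimes> (t n \<otimes> (p n \<otimes> r)) = p n \<otimes> s n \<otimes> r \<otimes> (t n \<otimes> inv (t n))"
      unfolding st(3)[of n] by (simp only: m_ac m_closed inv_closed
        \<open>p n \<in> carrier G\<close> \<open>s n \<in> carrier G\<close> \<open>t n \<in> carrier G\<close> \<open>r \<in> carrier G\<close>)
    also have "\<dots> = a" using r(2) by (simp add: p_Suc)
    finally have "a \<in> c n <# S"
      using st(2) p r(1) unfolding l_coset_def by (metis (no_types, lifting) S.m_closed UN_I singletonI)
    then show ?thesis using aS st(3)[of n] by (subst mem_translate_iff) auto
  qed
  then have "C \<subseteq> a <# set_inv S"
    using range_from_nat_into[OF False assms(2)] unfolding c_def by (metis image_subsetI)
  ultimately show ?thesis by blast
qed

section \<open>Condition (5) and countable o-compactness\<close>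

text \<open>Shifting by a representative \<open>g\<close> moves \<open>C\<close> into
  \<open>H\<close>, where the hypothesis gives a bound; shifting back adds \<open>g\<close> to the
  bound, which then need not lie in S.\<close>

lemma countable_coset_bounded:
  assumes bdd: "\<forall>C. countable C \<and> C \<subseteq> H \<longrightarrow> (\<exists>a\<in>S. C \<subseteq> a <# set_inv S)"
    and C: "countable C" "C \<subseteq> Q" and Q: "Q \<in> rcosets H"
  obtains a where "a \<in> carrier G" "C \<subseteq> a <# set_inv S"
proof -
  interpret H: subgroup H G by (rule subgroup_H)
  obtain g where g: "g \<in> carrier G" "Q = H #> g" using Q by (auto simp: RCOSETS_def)
  let ?D = "(\<lambda>c. c \<otimes> inv g) ` C"
  have "?D \<subseteq> H"
  proof clarify
    fix c assume "c \<in> C"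
    then obtain h where "h \<in> H" "c = h \<otimes> g" using C g by (auto simp: r_coset_def)
    then show "c \<otimes> inv g \<in> H" using g by (simp add: m_assoc)
  qed
  then obtain a where a: "a \<in> S" "?D \<subseteq> a <# set_inv S"
    using bdd C(1) by (meson countable_image)
  have "C \<subseteq> (a \<otimes> g) <# set_inv S"
  proof
    fix c assume c: "c \<in> C"
    then have cG: "c \<in> carrier G" using C Q rcosets_part_G[OF subgroup_H] by blast
    obtain s where s: "s \<in> S" "c \<otimes> inv g = a \<otimes> inv s"
      using a(2) c by (auto simp: l_coset_def SET_INV_def)
    have "c = c \<otimes> inv g \<otimes> g" using cG g by (simp add: m_assoc)
    also have "\<dots> = a \<otimes> g \<otimes> inv s" unfolding s(2) using a(1) s(1) g by (simp add: m_ac)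
    finally show "c \<in> (a \<otimes> g) <# set_inv S" using s(1) by (auto simp: l_coset_def SET_INV_def)
  qed
  moreover have "a \<otimes> g \<in> carrier G" using a g by simp
  ultimately show ?thesis using that by blast
qed

text \<open>One of the finitely many cosets meets \<open>A\<close> in an infinite set, and a
  countably infinite part of this intersection lies in a single a - S.\<close>

lemma countable_bounded_imp_infinite_Int:
  assumes fin: "finite_index H G"
    and bdd: "\<forall>C. countable C \<and> C \<subseteq> H \<longrightarrow> (\<exists>a\<in>S. C \<subseteq> a <# set_inv S)"
    and A: "A \<subseteq> carrier G" "infinite A"
  shows "\<exists>a\<in>carrier G. infinite (A \<inter> (a <# set_inv S))"
proof -
  have "A = (\<Union>Q\<in>rcosets H. A \<inter> Q)" using rcosets_part_G[OF subgroup_H] A(1) by blast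
  then obtain Q where Q: "Q \<in> rcosets H" "infinite (A \<inter> Q)"
    using fin A(2) unfolding finite_index_def by (metis finite_UN)
  obtain B where B: "B \<subseteq> A \<inter> Q" "infinite B" "countable B"
    using infinite_countable_subset'[OF Q(2)] by blast
  obtain a where a: "a \<in> carrier G" "B \<subseteq> a <# set_inv S"
    using countable_coset_bounded[OF bdd B(3) _ Q(1)] B(1) by blast
  have "B \<subseteq> A \<inter> (a <# set_inv S)" using B a by blast
  then show ?thesis using a(1) B(2) finite_subset by blast
qed

lemma infinite_Int_imp_countably_o_compact:
  assumes "\<forall>A. A \<subseteq> carrier G \<and> infinite A \<longrightarrow> (\<exists>a\<in>carrier G. infinite (A \<inter> (a <# set_inv S)))"
  shows "countably_o_compact X"
  unfolding countably_o_compact_def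
proof (intro allI impI, elim conjE)
  fix U :: "nat \<Rightarrow> 'a set"
  assume dec: "decseq U" and U: "\<forall>n. openin X (U n) \<and> U n \<noteq> {}"
  have "\<exists>v. v \<in> carrier G \<and> v <# S \<subseteq> U n" for n
    using U openin_contains_translate[of "U n"] by metis
  then obtain v where v: "\<And>n. v n \<in> carrier G" "\<And>n. v n <# S \<subseteq> U n" by metis
  \<comment> \<open>The point must lie in the cones at infinitely many indices, not merely at
    infinitely many values. If \<open>v\<close> has finite range, a value taken infinitely often is
    such a point; otherwise (5) applies to the range.\<close>
  obtain a where a: "infinite {n. a \<in> v n <# S}"
  proof (cases "finite (range v)")
    case True
    then obtain n where "infinite {m. v m = v n}"
      using pigeonhole_infinite[of "UNIV :: nat set" v] by auto
    moreover have "{m. v m = v n} \<subseteq> {m. v n \<in> v m <# S}"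
      using v(1) self_mem_translate by force
    ultimately show ?thesis using that finite_subset by blast
  next
    case False
    then obtain a where a: "a \<in> carrier G" "infinite (range v \<inter> (a <# set_inv S))"
      using assms v(1) by blast
    have "v n \<in> a <# set_inv S \<longleftrightarrow> a \<in> v n <# S" for n
      using a(1) v(1) by (rule mem_translate_iff)
    then have "range v \<inter> (a <# set_inv S) \<subseteq> v ` {n. a \<in> v n <# S}" by blast
    then show ?thesis using a(2) that finite_subset by blast
  qed
  \<comment> \<open>Infinitely many indices are unbounded, and a later \<open>U m\<close> is
    contained in \<open>U n\<close>.\<close>
  have "a \<in> U n" for n
  proof -
    obtain m where "m \<ge> n" "a \<in> v m <# S" using a by (auto simp: infinite_nat_iff_unbounded_le)
    then show ?thesis using v(2) dec unfolding decseq_def by blast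
  qed
  then show "(\<Inter>n. U n) \<noteq> {}" by blast
qed

text \<open>The inverse of a point common to all \<open>U n\<close> lies in every inverse set, hence
  in its closure.\<close>

lemma countably_o_compact_imp_two_pseudocompact:
  assumes "countably_o_compact X"
  shows "two_pseudocompact G X"
  unfolding two_pseudocompact_def
proof (intro allI impI, elim conjE)
  fix U :: "nat \<Rightarrow> 'a set"
  assume "decseq U" and U: "\<forall>n. openin X (U n) \<and> U n \<noteq> {}"
  then have "(\<Inter>n. U n) \<noteq> {}" using assms unfolding countably_o_compact_def by simp
  then obtain x where x: "\<And>n. x \<in> U n" by blast
  have "set_inv (U n) \<subseteq> topspace X" for n
    using openin_subset[of X "U n"] U unfolding topspace_cone SET_INV_def by auto
  then have "inv x \<in> X closure_of set_inv (U n)" for n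
    using x closure_of_subset[of "set_inv (U n)" X] unfolding SET_INV_def by blast
  then show "(\<Inter>n. X closure_of set_inv (U n)) \<noteq> {}" by blast
qed

section \<open>Passage to powers and back\<close>

text \<open>A basic neighbourhood restricts only finitely many coordinates. There the cluster point
  \<open>q\<close> yields arbitrarily late indices whose translating points lie in prescribed
  cosets, so a point built from \<open>q\<close> before any neighbourhood is given suffices.\<close>

lemma countable_bounded_imp_two_pseudocompact_power:
  fixes I :: "'i set"
  assumes fin: "finite_index H G"
    and bdd: "\<forall>C. countable C \<and> C \<subseteq> H \<longrightarrow> (\<exists>a\<in>S. C \<subseteq> a <# set_inv S)"
  shows "two_pseudocompact (product_group I (\<lambda>_. G)) (product_topology (\<lambda>_. X) I)"
  unfolding two_pseudocompact_def
proof (intro allI impI, elim conjE)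
  let ?P = "product_topology (\<lambda>_. X) I" and ?K = "product_group I (\<lambda>_. G)"
  let ?D = "product_topology (\<lambda>_::'i. discrete_topology (rcosets H)) I"
  fix U :: "nat \<Rightarrow> ('i \<Rightarrow> 'a) set"
  assume dec: "decseq U" and U: "\<forall>n. openin ?P (U n) \<and> U n \<noteq> {}"
  have "\<exists>W. (\<forall>i\<in>I. openin X (W i) \<and> W i \<noteq> {}) \<and> Pi\<^sub>E I W \<subseteq> U n" for n
  proof -
    obtain u where "u \<in> U n" using U by blast
    then obtain W where "\<forall>i\<in>I. openin X (W i)" "u \<in> Pi\<^sub>E I W" "Pi\<^sub>E I W \<subseteq> U n"
      using U[rule_format, of n] unfolding openin_product_topology_alt by blast
    then show ?thesis by (intro exI[of _ W]) (auto simp: PiE_iff)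
  qed
  then obtain W where W: "\<And>n i. i \<in> I \<Longrightarrow> openin X (W n i)" "\<And>n i. i \<in> I \<Longrightarrow> W n i \<noteq> {}"
    "\<And>n. Pi\<^sub>E I (W n) \<subseteq> U n" by metis
  have "\<forall>n i. \<exists>v. i \<in> I \<longrightarrow> v \<in> carrier G \<and> v <# S \<subseteq> W n i"
    using W(1,2) openin_contains_translate by metis
  then obtain v where v: "\<And>n i. i \<in> I \<Longrightarrow> v n i \<in> carrier G"
    "\<And>n i. i \<in> I \<Longrightarrow> v n i <# S \<subseteq> W n i"
    unfolding choice_iff by blast
  define w where "w n = (\<lambda>i\<in>I. H #> v n i)" for n
  \<comment> \<open>Tychonoff's theorem; finite index makes each discrete factor compact.\<close>
  have "compact_space ?D"
    using fin by (simp add: compact_space_product_topology compact_space_discrete_topology finite_index_def)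
  moreover have "w n \<in> topspace ?D" for n
    using v(1) by (auto simp: w_def RCOSETS_def)
  ultimately obtain q where q: "q \<in> topspace ?D"
    "\<And>N n. openin ?D N \<Longrightarrow> q \<in> N \<Longrightarrow> \<exists>m\<ge>n. w m \<in> N"
    using compact_space_cluster_point by blast
  have cluster: "\<exists>m\<ge>n. \<forall>i\<in>E. v m i \<in> q i" if E: "finite E" "E \<subseteq> I" for E n
  proof -
    let ?N = "Pi\<^sub>E I (\<lambda>i. if i \<in> E then {q i} else rcosets H)"
    have "openin ?D ?N"
      unfolding openin_PiE_gen using q(1) E finite_subset[OF _ E(1)] by (auto simp: PiE_iff)
    moreover have "q \<in> ?N" using q(1) by (auto simp: PiE_iff)
    ultimately obtain m where m: "m \<ge> n" "w m \<in> ?N" using q(2) by blast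
    have "v m i \<in> q i" if "i \<in> E" for i
    proof -
      have i: "i \<in> I" using E that by blast
      then have "w m i = q i" using m(2) that by (auto simp: PiE_iff)
      then show ?thesis using rcos_self[OF v(1)[OF i, of m] subgroup_H] i by (simp add: w_def)
    qed
    then show ?thesis using m(1) by blast
  qed
  \<comment> \<open>The translating points at coordinate \<open>i\<close> that fall into the coset
    \<open>q i\<close> form a countable set, so one \<open>a\<close> serves all indices
    \<open>m\<close> concerned.\<close>
  have "\<exists>a. i \<in> I \<longrightarrow> a \<in> carrier G \<and> (\<forall>m. v m i \<in> q i \<longrightarrow> a \<in> v m i <# S)" for i
  proof (cases "i \<in> I")
    case True
    let ?C = "{c \<in> range (\<lambda>m. v m i). c \<in> q i}"
    have "q i \<in> rcosets H" using q(1) True by auto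
    then obtain a where "a \<in> carrier G" "?C \<subseteq> a <# set_inv S"
      using countable_coset_bounded[OF bdd, of ?C "q i"] by auto
    then show ?thesis using mem_translate_iff v(1)[OF True] by blast
  qed simp
  then obtain a where a: "\<And>i. i \<in> I \<Longrightarrow> a i \<in> carrier G"
    "\<And>i m. i \<in> I \<Longrightarrow> v m i \<in> q i \<Longrightarrow> a i \<in> v m i <# S" by metis
  define y where "y = (\<lambda>i\<in>I. inv (a i))"
  have "y \<in> ?P closure_of set_inv\<^bsub>?K\<^esub> (U n)" for n
    unfolding in_closure_of
  proof (intro conjI allI impI)
    show "y \<in> topspace ?P" using a(1) by (auto simp: y_def topspace_cone)
  next
    fix T assume "y \<in> T \<and> openin ?P T"
    then obtain T' where T': "finite {i \<in> I. T' i \<noteq> topspace X}" "y \<in> Pi\<^sub>E I T'" "Pi\<^sub>E I T' \<subseteq> T"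
      unfolding openin_product_topology_alt by blast
    define E where "E = {i \<in> I. T' i \<noteq> topspace X}"
    obtain m where m: "m \<ge> n" "\<And>i. i \<in> E \<Longrightarrow> v m i \<in> q i"
      using cluster[of E n] T'(1) unfolding E_def by auto
    \<comment> \<open>On \<open>E\<close> the value \<open>a i\<close> makes the inverse of
      \<open>z\<close> agree with \<open>y\<close>; off \<open>E\<close>, where \<open>T'\<close>
      imposes nothing, \<open>v m i\<close> keeps \<open>z\<close> in the box
      \<open>W m\<close>.\<close>
    define z where "z = (\<lambda>i\<in>I. if i \<in> E then a i else v m i)"
    have "z \<in> Pi\<^sub>E I (W m)"
      unfolding z_def
    proof (rule restrict_PiE_iff[THEN iffD2], rule ballI)
      fix i assume i: "i \<in> I"
      have "(if i \<in> E then a i else v m i) \<in> v m i <# S"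
        using a(2)[OF i] m(2) self_mem_translate[OF v(1)[OF i]] by simp
      then show "(if i \<in> E then a i else v m i) \<in> W m i" using v(2)[OF i] by blast
    qed
    then have zU: "z \<in> U n" using W(3) dec m(1) unfolding decseq_def by blast
    have z: "z \<in> carrier ?K" using a(1) v(1) by (auto simp: z_def carrier_product_group)
    have "inv\<^bsub>?K\<^esub> z = (\<lambda>i\<in>I. inv (z i))"
      using z by (intro inv_product_group) (auto simp: carrier_product_group group_axioms)
    moreover have "(\<lambda>i\<in>I. inv (z i)) \<in> Pi\<^sub>E I T'"
    proof (rule restrict_PiE_iff[THEN iffD2], rule ballI)
      fix i assume i: "i \<in> I"
      show "inv (z i) \<in> T' i"
      proof (cases "i \<in> E")
        case True
        then have "inv (z i) = y i" using i by (simp add: z_def y_def)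
        then show ?thesis using T'(2) i by auto
      next
        case False
        then have "T' i = carrier G" using i by (auto simp: E_def topspace_cone)
        then show ?thesis using False i v(1) by (simp add: z_def)
      qed
    qed
    ultimately have "inv\<^bsub>?K\<^esub> z \<in> T" using T'(3) by (metis subsetD)
    moreover have "inv\<^bsub>?K\<^esub> z \<in> set_inv\<^bsub>?K\<^esub> (U n)" using zU by (auto simp: SET_INV_def)
    ultimately show "\<exists>x. x \<in> set_inv\<^bsub>?K\<^esub> (U n) \<and> x \<in> T" by blast
  qed
  then show "(\<Inter>n. ?P closure_of set_inv\<^bsub>?K\<^esub> (U n)) \<noteq> {}" by blast
qed

text \<open>The coordinate projection is continuous and maps the inverse of a box over
  \<open>U n\<close> into the inverse of \<open>U n\<close>, so it carries a point of the closures
  to a point of the closures.\<close>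

lemma two_pseudocompact_singleton_power_imp:
  fixes i :: 'i
  assumes "two_pseudocompact (product_group {i} (\<lambda>_. G)) (product_topology (\<lambda>_. X) {i})"
  shows "two_pseudocompact G X"
  unfolding two_pseudocompact_def
proof (intro allI impI, elim conjE)
  let ?P = "product_topology (\<lambda>_. X) {i}" and ?K = "product_group {i} (\<lambda>_. G)"
  fix U :: "nat \<Rightarrow> 'a set"
  assume dec: "decseq U" and U: "\<forall>n. openin X (U n) \<and> U n \<noteq> {}"
  define V where "V n = Pi\<^sub>E {i} (\<lambda>_. U n)" for n
  have "decseq V" using dec unfolding V_def decseq_def by (auto intro!: PiE_mono)
  moreover have "openin ?P (V n) \<and> V n \<noteq> {}" for n
    using U unfolding V_def by (auto simp: openin_PiE_gen PiE_eq_empty_iff)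
  ultimately have "(\<Inter>n. ?P closure_of set_inv\<^bsub>?K\<^esub> (V n)) \<noteq> {}"
    using assms unfolding two_pseudocompact_def by simp
  then obtain y where y: "\<And>n. y \<in> ?P closure_of set_inv\<^bsub>?K\<^esub> (V n)" by blast
  have "y i \<in> X closure_of set_inv (U n)" for n
  proof -
    have "(\<lambda>x. x i) ` (set_inv\<^bsub>?K\<^esub> (V n)) \<subseteq> set_inv (U n)"
    proof clarify
      fix x assume "x \<in> set_inv\<^bsub>?K\<^esub> (V n)"
      then obtain f where f: "f \<in> V n" "x = inv\<^bsub>?K\<^esub> f" by (auto simp: SET_INV_def)
      have fU: "f i \<in> U n" using f(1) by (auto simp: V_def)
      have "f \<in> carrier ?K"
        using f(1) openin_subset[of X "U n"] U unfolding V_def carrier_product_group topspace_cone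
        by (auto simp: PiE_iff)
      then have "x i = inv (f i)"
        using f(2) by (subst (asm) inv_product_group) (auto simp: carrier_product_group group_axioms)
      then show "x i \<in> set_inv (U n)" using fU by (auto simp: SET_INV_def)
    qed
    then have "X closure_of ((\<lambda>x. x i) ` (set_inv\<^bsub>?K\<^esub> (V n))) \<subseteq> X closure_of set_inv (U n)"
      by (rule closure_of_mono)
    moreover have "continuous_map ?P X (\<lambda>x. x i)"
      by (rule continuous_map_product_projection) simp
    ultimately show ?thesis using y[of n] continuous_map_image_closure_subset by blast
  qed
  then show "(\<Inter>n. X closure_of set_inv (U n)) \<noteq> {}" by blast
qed

end

theorem proposition5p18:
  fixes G :: "('a, 'b) monoid_scheme" and S :: "'a set"
  assumes "comm_group G" and "submonoid S G"
  defines "c1 \<equiv> two_pseudocompact G (cone_topology G S)"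
    and "c2 \<equiv> (\<forall>I :: 'i set. two_pseudocompact (product_group I (\<lambda>_. G))
                              (product_topology (\<lambda>_. cone_topology G S) I))"
    and "c3 \<equiv> countably_o_compact (cone_topology G S)"
    and "c4 \<equiv> finite_index (S <#>\<^bsub>G\<^esub> set_inv\<^bsub>G\<^esub> S) G \<and>
               (\<forall>C. countable C \<and> C \<subseteq> S <#>\<^bsub>G\<^esub> set_inv\<^bsub>G\<^esub> S \<longrightarrow>
                  (\<exists>a\<in>S. C \<subseteq> a <#\<^bsub>G\<^esub> (set_inv\<^bsub>G\<^esub> S)))"
    and "c5 \<equiv> (\<forall>A. A \<subseteq> carrier G \<and> infinite A \<longrightarrow>
                  (\<exists>a\<in>carrier G. infinite (A \<inter> (a <#\<^bsub>G\<^esub> (set_inv\<^bsub>G\<^esub> S)))))"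
  shows "(c1 \<longleftrightarrow> c2) \<and> (c1 \<longleftrightarrow> c3) \<and> (c1 \<longleftrightarrow> c4) \<and> (c1 \<longleftrightarrow> c5)"
proof -
  interpret cone G S using assms(1,2) by (rule cone.intro)
  have "c1 \<Longrightarrow> c4"
    unfolding c1_def c4_def
    using two_pseudocompact_imp_finite_index two_pseudocompact_imp_countable_bounded by blast
  moreover have "c4 \<Longrightarrow> c5"
    unfolding c4_def c5_def using countable_bounded_imp_infinite_Int by blast
  moreover have "c5 \<Longrightarrow> c3"
    unfolding c5_def c3_def by (rule infinite_Int_imp_countably_o_compact)
  moreover have "c3 \<Longrightarrow> c1"
    unfolding c3_def c1_def by (rule countably_o_compact_imp_two_pseudocompact)
  moreover have "c4 \<Longrightarrow> c2"
    unfolding c4_def c2_def using countable_bounded_imp_two_pseudocompact_power by blast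
  \<comment> \<open>Every type is inhabited, so \<open>undefined\<close> supplies a one-element
    index set.\<close>
  moreover have "c2 \<Longrightarrow> c1"
    unfolding c2_def c1_def
    by (rule two_pseudocompact_singleton_power_imp[of "undefined :: 'i"]) (erule spec)
  ultimately show ?thesis by blast
qed

end
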